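(* Let $U,\mathcal A\subset\mathcal D'(\mathbb R,X)$, where $\mathcal A$ satisfies the Loomis condition $(L'_U)$, is linear and contains all the constants. If $T\in\mathcal D'_{\mathcal A}(\mathbb R,X)$ and $\widetilde PT\in\mathcal D'_U(\mathbb R,X)$, then $\widetilde PT\in\mathcal D'_{\mathcal A}(\mathbb R,X)$.
   Context: $X$ is a Banach space over $\mathbb K=\mathbb R$ or $\mathbb C$. $\mathcal D(\mathbb R,\mathbb K)$: Schwartz test functions; $\mathcal D'(\mathbb R,X)$: linear continuous maps $\mathcal D(\mathbb R,\mathbb K)\to X$; locally Bochner integrable functions are identified with the distributions they define. $(T*\varphi)(x)=T(y\mapsto\varphi(x-y))$; for $\mathcal B\subset\mathcal D'(\mathbb R,X)$, $\mathcal D'_{\mathcal B}(\mathbb R,X)=\{T\in\mathcal D'(\mathbb R,X):T*\varphi\in\mathcal B\ \forall\varphi\in\mathcal D(\mathbb R,\mathbb K)\}$. Translates and differences: $T_a(\varphi)=T(\varphi_{-a})$ with $\varphi_a(t)=\varphi(t+a)$; $\Delta_hT=T_h-T$. $(L'_U)$ for $\mathcal A$: if $T\in U$ and $\Delta_hT\in\mathcal A$ for all $h>0$, then $T\in\mathcal A$. $\widetilde P:\mathcal D'(\mathbb R,X)\to\mathcal D'(\mathbb R,X)$ is a linear continuous operator with $(\widetilde PT)'=T$ for all $T\in\mathcal D'(\mathbb R,X)$ (an extension of indefinite integration to distributions). *)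

theory Defs
  imports "HOL-Analysis.Analysis" "HOL-Library.Function_Algebras"
begin

section \<open>Banach spaces over the real or complex numbers\<close>

text \<open>
  By the theorems of Gelfand--Mazur and Ostrowski, a complete type of class
  \<^class>\<open>real_normed_field\<close> is, up to isometric isomorphism, either \<^typ>\<open>real\<close> or
  \<^typ>\<open>complex\<close>; so \<open>'k\<close> stands for the scalar field of either case. Since
  \<^class>\<open>banach\<close> only provides the real structure, the multiplication by scalars in \<open>'k\<close> is an
  explicit parameter, required to extend \<^const>\<open>scaleR\<close>.
\<close>

locale banach_space_over = vector_space smul
  for smul :: "'k::{real_normed_field,banach} \<Rightarrow> 'x::banach \<Rightarrow> 'x" +
  assumes smul_of_real: "smul (of_real r) x = r *\<^sub>R x"
    and norm_smul: "norm (smul c x) = norm c * norm x"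


section \<open>Test functions\<close>

definition vderiv :: "(real \<Rightarrow> 'a::real_normed_vector) \<Rightarrow> real \<Rightarrow> 'a" where
  "vderiv f = (\<lambda>t. vector_derivative f (at t))"

definition smooth :: "(real \<Rightarrow> 'a::real_normed_vector) \<Rightarrow> bool" where
  "smooth f \<longleftrightarrow> (\<forall>n t. (vderiv ^^ n) f differentiable (at t))"

definition tsupport :: "(real \<Rightarrow> 'a::zero) \<Rightarrow> real set" where
  "tsupport f = closure {t. f t \<noteq> 0}"

lemma smooth_0: "smooth (\<lambda>t. 0)"
proof -
  have "(vderiv ^^ n) (\<lambda>t. 0 :: 'a) = (\<lambda>t. 0)" for n
    by (induction n) (auto simp: vderiv_def)
  then show ?thesis by (simp add: smooth_def)
qed

lemma smooth_has_vector_derivative: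
  assumes "smooth f"
  shows "((vderiv ^^ n) f has_vector_derivative (vderiv ^^ Suc n) f t) (at t)"
proof -
  have "(vderiv ^^ n) f differentiable (at t)" using assms by (simp add: smooth_def)
  then show ?thesis by (simp add: vderiv_def vector_derivative_works)
qed

lemma smoothI:
  assumes "F 0 = f" and "\<And>n t. (F n has_vector_derivative F (Suc n) t) (at t)"
  shows "smooth f" "(vderiv ^^ n) f = F n"
proof -
  have *: "(vderiv ^^ n) f = F n" for n
  proof (induction n)
    case (Suc n)
    have "(vderiv ^^ Suc n) f = vderiv (F n)" using Suc by simp
    also have "\<dots> = F (Suc n)"
      unfolding vderiv_def using assms(2) vector_derivative_at by blast
    finally show ?case .
  qed (simp add: assms)
  show "(vderiv ^^ n) f = F n" by (rule *)
  show "smooth f"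
    unfolding smooth_def * using assms(2) differentiableI_vector by blast
qed

lemma
  assumes "smooth f" "smooth g"
  shows smooth_add: "smooth (\<lambda>t. f t + g t)"
    and vderiv_add: "(vderiv ^^ n) (\<lambda>t. f t + g t) = (\<lambda>t. (vderiv ^^ n) f t + (vderiv ^^ n) g t)"
proof -
  let ?F = "\<lambda>n t. (vderiv ^^ n) f t + (vderiv ^^ n) g t"
  have "(?F n has_vector_derivative ?F (Suc n) t) (at t)" for n t
    by (intro has_vector_derivative_add smooth_has_vector_derivative assms)
  then show "smooth (\<lambda>t. f t + g t)" "(vderiv ^^ n) (\<lambda>t. f t + g t) = ?F n"
    by (intro smoothI[of ?F]; simp)+
qed

lemma
  fixes f :: "real \<Rightarrow> 'k::real_normed_field"
  assumes "smooth f"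
  shows smooth_mult: "smooth (\<lambda>t. c * f t)"
    and vderiv_mult: "(vderiv ^^ n) (\<lambda>t. c * f t) = (\<lambda>t. c * (vderiv ^^ n) f t)"
proof -
  let ?F = "\<lambda>n t. c * (vderiv ^^ n) f t"
  have "(?F n has_vector_derivative ?F (Suc n) t) (at t)" for n t
    by (intro has_vector_derivative_mult_right smooth_has_vector_derivative assms)
  then show "smooth (\<lambda>t. c * f t)" "(vderiv ^^ n) (\<lambda>t. c * f t) = ?F n"
    by (intro smoothI[of ?F]; simp)+
qed

lemma
  assumes "smooth f"
  shows smooth_affine: "smooth (\<lambda>t. f (a + b * t))"
    and vderiv_affine:
      "(vderiv ^^ n) (\<lambda>t. f (a + b * t)) = (\<lambda>t. b ^ n *\<^sub>R (vderiv ^^ n) f (a + b * t))"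
proof -
  let ?F = "\<lambda>n t. b ^ n *\<^sub>R (vderiv ^^ n) f (a + b * t)"
  have "(?F n has_vector_derivative ?F (Suc n) t) (at t)" for n t
  proof -
    have "((\<lambda>t. a + b * t) has_vector_derivative b) (at t)"
      by (auto intro!: derivative_eq_intros)
    then have "((vderiv ^^ n) f \<circ> (\<lambda>t. a + b * t) has_vector_derivative
        b *\<^sub>R (vderiv ^^ Suc n) f (a + b * t)) (at t)"
      by (rule vector_diff_chain_at) (rule smooth_has_vector_derivative[OF assms])
    then have "((\<lambda>t. b ^ n *\<^sub>R ((vderiv ^^ n) f \<circ> (\<lambda>t. a + b * t)) t) has_vector_derivative
        b ^ n *\<^sub>R b *\<^sub>R (vderiv ^^ Suc n) f (a + b * t)) (at t)"
      by (intro bounded_linear.has_vector_derivative[OF bounded_linear_scaleR_right])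
    then show ?thesis by (simp add: o_def mult.commute)
  qed
  then show "smooth (\<lambda>t. f (a + b * t))" "(vderiv ^^ n) (\<lambda>t. f (a + b * t)) = ?F n"
    by (intro smoothI[of ?F]; simp)+
qed

lemma smooth_vderiv:
  assumes "smooth f" shows "smooth (vderiv f)"
  by (rule smoothI[of "\<lambda>n. (vderiv ^^ Suc n) f"]) (simp, rule smooth_has_vector_derivative[OF assms])

lemma outside_tsupport: "t \<notin> tsupport f \<Longrightarrow> f t = 0"
  using closure_subset[of "{t. f t \<noteq> 0}"] unfolding tsupport_def by auto

lemma compact_tsupportI:
  assumes "compact K" and "\<And>t. t \<notin> K \<Longrightarrow> f t = 0"
  shows "compact (tsupport f)"
proof -
  have "bounded {t. f t \<noteq> 0}"
    by (rule bounded_subset[OF compact_imp_bounded[OF assms(1)]]) (use assms(2) in auto)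
  then show ?thesis by (simp add: tsupport_def compact_closure)
qed

lemma compact_tsupport_add:
  fixes f g :: "real \<Rightarrow> 'a::monoid_add"
  assumes "compact (tsupport f)" "compact (tsupport g)"
  shows "compact (tsupport (\<lambda>t. f t + g t))"
  by (rule compact_tsupportI[OF compact_Un[OF assms]]) (simp add: outside_tsupport)

lemma compact_tsupport_affine:
  assumes "compact (tsupport f)" "b \<noteq> 0"
  shows "compact (tsupport (\<lambda>t. f (a + b * t)))"
proof (rule compact_tsupportI)
  have "continuous_on (tsupport f) (\<lambda>s. (s - a) / b)"
    using assms(2) by (intro continuous_on_divide continuous_on_diff continuous_on_id
        continuous_on_const) simp
  then show "compact ((\<lambda>s. (s - a) / b) ` tsupport f)"
    by (rule compact_continuous_image) (rule assms(1))
  fix t assume t: "t \<notin> (\<lambda>s. (s - a) / b) ` tsupport f"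
  have "t = (a + b * t - a) / b" using assms(2) by simp
  then have "a + b * t \<notin> tsupport f" using t by blast
  then show "f (a + b * t) = 0" by (rule outside_tsupport)
qed

lemma compact_tsupport_vderiv:
  assumes "compact (tsupport f)" shows "compact (tsupport (vderiv f))"
proof (rule compact_tsupportI[OF assms])
  fix t assume t: "t \<notin> tsupport f"
  have "open (- tsupport f)" by (simp add: tsupport_def open_Compl)
  moreover have "((\<lambda>_. 0) has_vector_derivative 0) (at t)" by simp
  ultimately have "(f has_vector_derivative 0) (at t)"
    using t outside_tsupport[of _ f]
    by (intro has_vector_derivative_transform_within_open[of "\<lambda>_. 0" 0 t "- tsupport f" f]) auto
  then show "vderiv f t = 0" by (simp add: vderiv_def vector_derivative_at)
qed

typedef (overloaded) 'k test_fun =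
    "{f :: real \<Rightarrow> 'k::real_normed_field. smooth f \<and> compact (tsupport f)}"
  morphisms tf_apply Abs_test_fun
  by (rule exI[of _ "\<lambda>_. 0"]) (simp add: smooth_0 tsupport_def)

setup_lifting type_definition_test_fun

lift_definition tf_scale :: "'k::real_normed_field \<Rightarrow> 'k test_fun \<Rightarrow> 'k test_fun"
  is "\<lambda>c f t. c * f t"
  subgoal for c f
    using smooth_mult[of f c] compact_tsupportI[of "tsupport f" "\<lambda>t. c * f t"]
    by (simp add: outside_tsupport)
  done

lift_definition tf_shift :: "real \<Rightarrow> 'k::real_normed_field test_fun \<Rightarrow> 'k test_fun"
  is "\<lambda>a f t. f (t + a)"
  subgoal for a f
    using smooth_affine[of f a 1] compact_tsupport_affine[of f 1 a] by (simp add: add.commute)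
  done

lift_definition tf_reflect :: "real \<Rightarrow> 'k::real_normed_field test_fun \<Rightarrow> 'k test_fun"
  is "\<lambda>x f y. f (x - y)"
  subgoal for x f
    using smooth_affine[of f x "-1"] compact_tsupport_affine[of f "-1" x] by simp
  done

lift_definition tf_deriv :: "'k::real_normed_field test_fun \<Rightarrow> 'k test_fun"
  is vderiv
  by (simp add: smooth_vderiv compact_tsupport_vderiv)

instantiation test_fun :: (real_normed_field) ab_group_add
begin

lift_definition zero_test_fun :: "'a test_fun" is "\<lambda>t. 0"
  by (simp add: smooth_0 tsupport_def)

lift_definition plus_test_fun :: "'a test_fun \<Rightarrow> 'a test_fun \<Rightarrow> 'a test_fun" is "\<lambda>f g t. f t + g t"
  by (simp add: smooth_add compact_tsupport_add)

definition uminus_test_fun :: "'a test_fun \<Rightarrow> 'a test_fun" where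
  "- \<phi> = tf_scale (-1) \<phi>"

definition minus_test_fun :: "'a test_fun \<Rightarrow> 'a test_fun \<Rightarrow> 'a test_fun" where
  "\<phi> - \<psi> = \<phi> + - (\<psi> :: 'a test_fun)"

instance
proof
  fix a b c :: "'a test_fun"
  show "a + b + c = a + (b + c)" by transfer (simp add: add.assoc)
  show "a + b = b + a" by transfer (simp add: add.commute)
  show "0 + a = a" by transfer simp
  show "- a + a = 0" unfolding uminus_test_fun_def by transfer simp
  show "a - b = a + - b" by (rule minus_test_fun_def)
qed

end

lemma vector_space_tf_scale: "vector_space tf_scale"
  by unfold_locales (transfer; simp add: algebra_simps)+


section \<open>The topology of the space of test functions\<close>

text \<open>
  The usual locally convex inductive limit topology: a base of neighbourhoods of \<open>0\<close> is formed by
  the absolutely convex sets whose trace on each space of test functions supported in a fixed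
  compact set \<open>K\<close> is a neighbourhood of \<open>0\<close> for the uniform convergence of all derivatives.
\<close>

definition tf_nbhd0 :: "'k::real_normed_field test_fun set \<Rightarrow> bool" where
  "tf_nbhd0 W \<longleftrightarrow>
     (\<forall>\<phi>\<in>W. \<forall>\<psi>\<in>W. \<forall>c d. norm c + norm d \<le> 1 \<longrightarrow> tf_scale c \<phi> + tf_scale d \<psi> \<in> W) \<and>
     (\<forall>K. compact K \<longrightarrow> (\<exists>N. \<exists>\<epsilon>>0. \<forall>\<phi>.
        tsupport (tf_apply \<phi>) \<subseteq> K \<and> (\<forall>j\<le>N. \<forall>t. norm ((vderiv ^^ j) (tf_apply \<phi>) t) < \<epsilon>)
        \<longrightarrow> \<phi> \<in> W))"

lemma tf_nbhd0_UNIV: "tf_nbhd0 UNIV"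
  unfolding tf_nbhd0_def by (simp add: exI[of _ "1::real"])

lemma tf_nbhd0_Int:
  assumes "tf_nbhd0 V" "tf_nbhd0 W"
  shows "tf_nbhd0 (V \<inter> W)"
  unfolding tf_nbhd0_def
proof (intro conjI allI impI)
  show "\<forall>\<phi>\<in>V \<inter> W. \<forall>\<psi>\<in>V \<inter> W. \<forall>c d. norm c + norm d \<le> 1 \<longrightarrow>
      tf_scale c \<phi> + tf_scale d \<psi> \<in> V \<inter> W"
    using assms by (simp add: tf_nbhd0_def)
next
  fix K :: "real set" assume K: "compact K"
  from assms(1) have "\<exists>N. \<exists>\<epsilon>>0. \<forall>\<phi>. tsupport (tf_apply \<phi>) \<subseteq> K \<and>
      (\<forall>j\<le>N. \<forall>t. norm ((vderiv ^^ j) (tf_apply \<phi>) t) < \<epsilon>) \<longrightarrow> \<phi> \<in> V"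
    unfolding tf_nbhd0_def using K by simp
  then obtain N \<epsilon> where 1: "\<epsilon> > 0" "\<forall>\<phi>. tsupport (tf_apply \<phi>) \<subseteq> K \<and>
      (\<forall>j\<le>N. \<forall>t. norm ((vderiv ^^ j) (tf_apply \<phi>) t) < \<epsilon>) \<longrightarrow> \<phi> \<in> V"
    by (elim exE conjE)
  from assms(2) have "\<exists>N. \<exists>\<epsilon>>0. \<forall>\<phi>. tsupport (tf_apply \<phi>) \<subseteq> K \<and>
      (\<forall>j\<le>N. \<forall>t. norm ((vderiv ^^ j) (tf_apply \<phi>) t) < \<epsilon>) \<longrightarrow> \<phi> \<in> W"
    unfolding tf_nbhd0_def using K by simp
  then obtain M \<delta> where 2: "\<delta> > 0" "\<forall>\<phi>. tsupport (tf_apply \<phi>) \<subseteq> K \<and>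
      (\<forall>j\<le>M. \<forall>t. norm ((vderiv ^^ j) (tf_apply \<phi>) t) < \<delta>) \<longrightarrow> \<phi> \<in> W"
    by (elim exE conjE)
  show "\<exists>N. \<exists>\<epsilon>>0. \<forall>\<phi>. tsupport (tf_apply \<phi>) \<subseteq> K \<and>
      (\<forall>j\<le>N. \<forall>t. norm ((vderiv ^^ j) (tf_apply \<phi>) t) < \<epsilon>) \<longrightarrow> \<phi> \<in> V \<inter> W"
    using 1 2 by (intro exI[of _ "max N M"] exI[of _ "min \<epsilon> \<delta>"]) simp
qed

instantiation test_fun :: (real_normed_field) topological_space
begin

definition open_test_fun :: "'a test_fun set \<Rightarrow> bool" where
  "open S \<longleftrightarrow> (\<forall>\<phi>\<in>S. \<exists>W. tf_nbhd0 W \<and> (\<forall>\<psi>\<in>W. \<phi> + \<psi> \<in> (S :: 'a test_fun set)))"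

instance
proof
  show "open (UNIV :: 'a test_fun set)"
    unfolding open_test_fun_def using tf_nbhd0_UNIV by (intro ballI exI[of _ UNIV]) simp
next
  fix S T :: "'a test_fun set"
  assume S: "open S" and T: "open T"
  show "open (S \<inter> T)"
    unfolding open_test_fun_def
  proof
    fix \<phi> assume \<phi>: "\<phi> \<in> S \<inter> T"
    from S \<phi> obtain V where V: "tf_nbhd0 V" "\<forall>\<psi>\<in>V. \<phi> + \<psi> \<in> S"
      unfolding open_test_fun_def by (elim IntE) (drule (1) bspec, elim exE conjE)
    from T \<phi> obtain W where W: "tf_nbhd0 W" "\<forall>\<psi>\<in>W. \<phi> + \<psi> \<in> T"
      unfolding open_test_fun_def by (elim IntE) (drule (1) bspec, elim exE conjE)
    show "\<exists>W. tf_nbhd0 W \<and> (\<forall>\<psi>\<in>W. \<phi> + \<psi> \<in> S \<inter> T)"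
      using V W by (intro exI[of _ "V \<inter> W"]) (simp add: tf_nbhd0_Int)
  qed
next
  fix \<K> :: "'a test_fun set set"
  assume K: "\<forall>S\<in>\<K>. open S"
  show "open (\<Union>\<K>)"
    unfolding open_test_fun_def
  proof
    fix \<phi> assume "\<phi> \<in> \<Union>\<K>"
    then obtain S where S: "S \<in> \<K>" "\<phi> \<in> S" by (rule UnionE)
    with K have "open S" by simp
    then obtain W where W: "tf_nbhd0 W" "\<forall>\<psi>\<in>W. \<phi> + \<psi> \<in> S"
      using S(2) unfolding open_test_fun_def by (drule_tac bspec) (assumption, elim exE conjE)
    then show "\<exists>W. tf_nbhd0 W \<and> (\<forall>\<psi>\<in>W. \<phi> + \<psi> \<in> \<Union>\<K>)"
      using S(1) by (intro exI[of _ W] conjI ballI UnionI[OF S(1)]) simp_all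
  qed
qed

end

definition tf_bounded :: "'k::real_normed_field test_fun set \<Rightarrow> bool" where
  "tf_bounded B \<longleftrightarrow>
     (\<forall>W. open W \<and> 0 \<in> W \<longrightarrow> (\<exists>s>0. \<forall>r>s. B \<subseteq> tf_scale (of_real r) ` W))"

lemma tf_bounded_Un:
  assumes "tf_bounded A" "tf_bounded B"
  shows "tf_bounded (A \<union> B)"
  unfolding tf_bounded_def
proof (intro allI impI)
  fix W :: "'a test_fun set"
  assume W: "open W \<and> 0 \<in> W"
  from assms(1)[unfolded tf_bounded_def, rule_format, OF W]
  obtain s where s: "s > 0" "\<forall>r>s. A \<subseteq> tf_scale (of_real r) ` W" by (elim exE conjE)
  from assms(2)[unfolded tf_bounded_def, rule_format, OF W]
  obtain t where t: "t > 0" "\<forall>r>t. B \<subseteq> tf_scale (of_real r) ` W" by (elim exE conjE)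
  show "\<exists>s>0. \<forall>r>s. A \<union> B \<subseteq> tf_scale (of_real r) ` W"
    using s t by (intro exI[of _ "max s t"]) simp
qed


section \<open>Vector-valued distributions\<close>

definition distributions ::
    "('k::real_normed_field \<Rightarrow> 'x::banach \<Rightarrow> 'x) \<Rightarrow> ('k test_fun \<Rightarrow> 'x) set" where
  "distributions smul = {T. Vector_Spaces.linear tf_scale smul T \<and> continuous_on UNIV T}"

definition dist_scale ::
    "('k \<Rightarrow> 'x \<Rightarrow> 'x) \<Rightarrow> 'k \<Rightarrow> ('k::real_normed_field test_fun \<Rightarrow> 'x) \<Rightarrow> 'k test_fun \<Rightarrow> 'x" where
  "dist_scale smul c T = (\<lambda>\<phi>. smul c (T \<phi>))"

lemma (in banach_space_over) vector_space_dist_scale: "vector_space (dist_scale smul)"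
  by unfold_locales
    (auto simp: dist_scale_def fun_eq_iff scale_right_distrib scale_left_distrib)

text \<open>
  The topology of uniform convergence on bounded sets of test functions.
\<close>

definition dist_topology ::
    "('k::real_normed_field \<Rightarrow> 'x::banach \<Rightarrow> 'x) \<Rightarrow> ('k test_fun \<Rightarrow> 'x) topology" where
  "dist_topology smul = topology (\<lambda>\<O>. \<O> \<subseteq> distributions smul \<and>
     (\<forall>T\<in>\<O>. \<exists>B. \<exists>\<epsilon>>0. tf_bounded B \<and>
        {S \<in> distributions smul. \<forall>\<phi>\<in>B. norm (S \<phi> - T \<phi>) < \<epsilon>} \<subseteq> \<O>))"

lemma openin_dist_topology:
  "openin (dist_topology smul) \<O> \<longleftrightarrow> \<O> \<subseteq> distributions smul \<and>
     (\<forall>T\<in>\<O>. \<exists>B. \<exists>\<epsilon>>0. tf_bounded B \<and>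
        {S \<in> distributions smul. \<forall>\<phi>\<in>B. norm (S \<phi> - T \<phi>) < \<epsilon>} \<subseteq> \<O>)"
proof -
  let ?P = "\<lambda>\<O>. \<O> \<subseteq> distributions smul \<and>
     (\<forall>T\<in>\<O>. \<exists>B. \<exists>\<epsilon>>0. tf_bounded B \<and>
        {S \<in> distributions smul. \<forall>\<phi>\<in>B. norm (S \<phi> - T \<phi>) < \<epsilon>} \<subseteq> \<O>)"
  have "istopology ?P"
    unfolding istopology_def
  proof (rule conjI; intro allI impI)
    fix A B assume A: "?P A" and B: "?P B"
    have "\<exists>C. \<exists>\<epsilon>>0. tf_bounded C \<and>
        {S \<in> distributions smul. \<forall>\<phi>\<in>C. norm (S \<phi> - T \<phi>) < \<epsilon>} \<subseteq> A \<inter> B"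
      if T: "T \<in> A \<inter> B" for T
    proof -
      obtain C \<epsilon> where 1: "\<epsilon> > 0" "tf_bounded C"
        "{S \<in> distributions smul. \<forall>\<phi>\<in>C. norm (S \<phi> - T \<phi>) < \<epsilon>} \<subseteq> A" using A T by blast
      obtain D \<delta> where 2: "\<delta> > 0" "tf_bounded D"
        "{S \<in> distributions smul. \<forall>\<phi>\<in>D. norm (S \<phi> - T \<phi>) < \<delta>} \<subseteq> B" using B T by blast
      show ?thesis
        using 1 2 by (intro exI[of _ "C \<union> D"] exI[of _ "min \<epsilon> \<delta>"]) (auto simp: tf_bounded_Un)
    qed
    then show "?P (A \<inter> B)" using A by blast
  next
    fix \<K> assume *: "\<forall>K\<in>\<K>. ?P K"
    show "?P (\<Union>\<K>)"
    proof (intro conjI ballI)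
      show "\<Union>\<K> \<subseteq> distributions smul" using * by blast
      fix T assume "T \<in> \<Union>\<K>"
      then obtain K where K: "K \<in> \<K>" "T \<in> K" by blast
      then obtain B \<epsilon> where "\<epsilon> > 0" "tf_bounded B"
        "{S \<in> distributions smul. \<forall>\<phi>\<in>B. norm (S \<phi> - T \<phi>) < \<epsilon>} \<subseteq> K" using * by meson
      then show "\<exists>B. \<exists>\<epsilon>>0. tf_bounded B \<and>
        {S \<in> distributions smul. \<forall>\<phi>\<in>B. norm (S \<phi> - T \<phi>) < \<epsilon>} \<subseteq> \<Union>\<K>"
        using K by (intro exI[of _ B] exI[of _ \<epsilon>]) blast
    qed
  qed
  then show ?thesis unfolding dist_topology_def by (simp only: topology_inverse')
qed

lemma topspace_dist_topology: "topspace (dist_topology smul) = distributions smul"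
proof -
  have bdd: "tf_bounded {}"
    unfolding tf_bounded_def by (simp add: exI[of _ "1::real"])
  have "openin (dist_topology smul) (distributions smul)"
    unfolding openin_dist_topology
  proof (intro conjI ballI subset_refl)
    fix T assume "T \<in> distributions smul"
    show "\<exists>B. \<exists>\<epsilon>>0. tf_bounded B \<and>
        {S \<in> distributions smul. \<forall>\<phi>\<in>B. norm (S \<phi> - T \<phi>) < \<epsilon>} \<subseteq> distributions smul"
      by (intro exI[of _ "{}"] exI[of _ "1::real"]) (simp add: bdd)
  qed
  moreover have "topspace (dist_topology smul) \<subseteq> distributions smul"
    using openin_topspace[of "dist_topology smul"] unfolding openin_dist_topology by (rule conjunct1)
  ultimately show ?thesis by (simp add: openin_subset subset_antisym)
qed

text \<open>
  The distribution defined by a function. It is only used for continuous \<open>f\<close>, where the integrand is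
  continuous with compact support, so that the Henstock--Kurzweil integral exists and agrees with the
  Bochner integral; the latter is formalized only for second countable range spaces.
\<close>

definition dist_of_fun ::
    "('k::real_normed_field \<Rightarrow> 'x::banach \<Rightarrow> 'x) \<Rightarrow> (real \<Rightarrow> 'x) \<Rightarrow> 'k test_fun \<Rightarrow> 'x" where
  "dist_of_fun smul f = (\<lambda>\<phi>. integral UNIV (\<lambda>t. smul (tf_apply \<phi> t) (f t)))"

definition dist_deriv ::
    "('k::real_normed_field test_fun \<Rightarrow> 'x::banach) \<Rightarrow> 'k test_fun \<Rightarrow> 'x" where
  "dist_deriv T = (\<lambda>\<phi>. - T (tf_deriv \<phi>))"

definition dist_conv ::
    "('k::real_normed_field test_fun \<Rightarrow> 'x::banach) \<Rightarrow> 'k test_fun \<Rightarrow> real \<Rightarrow> 'x" where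
  "dist_conv T \<phi> = (\<lambda>x. T (tf_reflect x \<phi>))"

definition dist_translate ::
    "real \<Rightarrow> ('k::real_normed_field test_fun \<Rightarrow> 'x::banach) \<Rightarrow> 'k test_fun \<Rightarrow> 'x" where
  "dist_translate a T = (\<lambda>\<phi>. T (tf_shift (- a) \<phi>))"

definition dist_diff ::
    "real \<Rightarrow> ('k::real_normed_field test_fun \<Rightarrow> 'x::banach) \<Rightarrow> 'k test_fun \<Rightarrow> 'x" where
  "dist_diff h T = dist_translate h T - T"

text \<open>The class \<open>\<D>'\<^sub>\<B>\<close> of distributions whose convolutions with test functions all lie in \<open>\<B>\<close>.\<close>

definition conv_class ::
    "('k::real_normed_field \<Rightarrow> 'x::banach \<Rightarrow> 'x) \<Rightarrow> ('k test_fun \<Rightarrow> 'x) set \<Rightarrow>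
      ('k test_fun \<Rightarrow> 'x) set" where
  "conv_class smul \<B> = {T \<in> distributions smul. \<forall>\<phi>. dist_of_fun smul (dist_conv T \<phi>) \<in> \<B>}"

definition loomis ::
    "('k::real_normed_field test_fun \<Rightarrow> 'x::banach) set \<Rightarrow> ('k test_fun \<Rightarrow> 'x) set \<Rightarrow> bool" where
  "loomis U \<A> \<longleftrightarrow> (\<forall>T\<in>U. (\<forall>h>0. dist_diff h T \<in> \<A>) \<longrightarrow> T \<in> \<A>)"

end

theory Submission
  imports Defs
begin

text \<open>
  Differences of \<open>PT * \<phi>\<close> are again regularizations of \<open>T\<close>. For \<open>h > 0\<close> the moving integral
  \<open>\<psi> t = \<integral>\<^sub>t\<^bsup>t+h\<^esup> \<phi>\<close> is a test function with \<open>\<psi>' = \<phi>\<^sub>h - \<phi>\<close>; here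
  it is essential to work with a difference, since \<open>\<phi>\<close> alone need not have a compactly supported
  antiderivative. As \<open>(PT)' = T\<close>, moving the derivative from \<open>\<psi>\<close> to \<open>PT\<close> gives
  \<open>\<Delta>\<^sub>h (PT * \<phi>) = PT * \<psi>' = T * \<psi>\<close>, which lies in \<open>\<A>\<close>. The Loomis condition, applied to
  \<open>PT * \<phi> \<in> U\<close>, then yields \<open>PT * \<phi> \<in> \<A>\<close>.

  The identity between functions passes to the distributions they define only if the integrals can
  be subtracted, for which the integrands have to be integrable. So it must be known that \<open>S * \<phi>\<close>
  is a continuous function for every distribution \<open>S\<close>. This follows from the continuity of
  \<open>S\<close> once \<open>x \<mapsto> \<phi>(x - \<cdot>)\<close> is seen to be continuous into the space of test functions.
\<close>

section \<open>Moving integrals of test functions\<close>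

lemma smooth_continuous_on: "smooth f \<Longrightarrow> continuous_on S ((vderiv ^^ n) f)"
  using smooth_has_vector_derivative[of f n] has_vector_derivative_continuous
  by (metis continuous_at_imp_continuous_on)

lemma moving_integral_has_vector_derivative:
  fixes f :: "real \<Rightarrow> 'a::banach"
  assumes f: "continuous_on UNIV f" and h: "h > 0"
  shows "((\<lambda>t. integral {t..t + h} f) has_vector_derivative f (t + h) - f t) (at t)"
proof -
  \<comment> \<open>Near \<open>t\<close>, the moving integral is a difference of two integrals with the fixed lower end \<open>a\<close>.\<close>
  define a b where "a = t - 1" and "b = t + h + 1"
  have I: "f integrable_on {u..v}" for u v
    using f by (intro integrable_continuous_real) (rule continuous_on_subset, auto)
  have D: "((\<lambda>u. integral {a..u} f) has_vector_derivative f s) (at s)" if "a < s" "s < b" for s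
  proof -
    have "((\<lambda>u. integral {a..u} f) has_vector_derivative f s) (at s within {a..b})"
      using f that by (intro integral_has_vector_derivative) (auto intro: continuous_on_subset)
    then show ?thesis using that by (simp add: at_within_Icc_at)
  qed
  have sh: "((\<lambda>u. u + h) has_vector_derivative 1) (at t)"
    by (auto intro!: derivative_eq_intros)
  have "((\<lambda>u. integral {a..u} f) \<circ> (\<lambda>u. u + h) has_vector_derivative 1 *\<^sub>R f (t + h)) (at t)"
    by (rule vector_diff_chain_at[OF sh]) (rule D, use h in \<open>auto simp: a_def b_def\<close>)
  then have "((\<lambda>u. integral {a..u + h} f - integral {a..u} f)
      has_vector_derivative f (t + h) - f t) (at t)"
    using h by (intro has_vector_derivative_diff D) (auto simp: o_def a_def b_def)
  then show ?thesis
  proof (rule has_vector_derivative_transform_within_open[of _ _ _ "{a<..}"])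
    fix u assume "u \<in> {a<..}"
    then have "integral {a..u} f + integral {u..u + h} f = integral {a..u + h} f"
      using h by (intro Henstock_Kurzweil_Integration.integral_combine I) auto
    then show "integral {a..u + h} f - integral {a..u} f = integral {u..u + h} f"
      by (simp add: algebra_simps)
  qed (auto simp: a_def)
qed

lemma tf_apply_smooth: "smooth (tf_apply \<phi>)"
  and tf_apply_compact: "compact (tsupport (tf_apply \<phi>))"
  using tf_apply[of \<phi>] by auto

lemma tf_apply_minus: "tf_apply (\<phi> - \<psi>) t = tf_apply \<phi> t - tf_apply \<psi> t"
  unfolding minus_test_fun_def uminus_test_fun_def by transfer simp

lemma tf_apply_support_bound:
  obtains a where "\<And>t. \<bar>t\<bar> > a \<Longrightarrow> tf_apply \<phi> t = 0" "a > 0"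
proof -
  obtain a where a: "a > 0" "\<And>t. t \<in> tsupport (tf_apply \<phi>) \<Longrightarrow> norm t \<le> a"
    using compact_imp_bounded[OF tf_apply_compact[of \<phi>]] by (auto simp: bounded_pos)
  show thesis
  proof (rule that[of a])
    fix t :: real assume "\<bar>t\<bar> > a"
    then have "t \<notin> tsupport (tf_apply \<phi>)" using a(2)[of t] by fastforce
    then show "tf_apply \<phi> t = 0" by (rule outside_tsupport)
  qed (rule a(1))
qed

text \<open>
  The witness is the moving integral \<open>\<integral>\<^sub>t\<^bsup>t+h\<^esup> \<phi>\<close>. It vanishes as soon as the window
  \<open>[t, t + h]\<close> misses the support of \<open>\<phi>\<close>, so it has compact support even when \<open>\<integral> \<phi> \<noteq> 0\<close>.
\<close>

lemma tf_shift_minus_is_tf_deriv: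
  fixes \<phi> :: "'k::{real_normed_field,banach} test_fun"
  assumes h: "h > 0"
  shows "\<exists>\<psi>. tf_deriv \<psi> = tf_shift h \<phi> - \<phi>"
proof -
  let ?f = "tf_apply \<phi>"
  define g where "g = (\<lambda>t. integral {t..t + h} ?f)"
  \<comment> \<open>The successive derivatives of \<open>g\<close>; the argument \<open>h + 1 * t\<close> has the affine form
      to which the rule for derivatives of \<open>t \<mapsto> f (a + b * t)\<close> applies.\<close>
  let ?F = "\<lambda>n. case n of 0 \<Rightarrow> g | Suc m \<Rightarrow> (\<lambda>t. (vderiv ^^ m) ?f (h + 1 * t) - (vderiv ^^ m) ?f t)"
  have shifted: "((\<lambda>t. (vderiv ^^ m) ?f (h + 1 * t)) has_vector_derivative
      (vderiv ^^ Suc m) ?f (h + 1 * t)) (at t)" for m t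
    using smooth_has_vector_derivative[OF smooth_affine[OF tf_apply_smooth[of \<phi>], of h 1], of m t]
    by (simp only: vderiv_affine[OF tf_apply_smooth] power_one scaleR_one)
  have F: "(?F n has_vector_derivative ?F (Suc n) t) (at t)" for n t
  proof (cases n)
    case 0
    then show ?thesis
      using moving_integral_has_vector_derivative[of ?f h t] h
        smooth_continuous_on[OF tf_apply_smooth[of \<phi>], of UNIV 0]
      by (simp add: g_def add.commute)
  next
    case (Suc m)
    have "((\<lambda>t. (vderiv ^^ m) ?f (h + 1 * t) - (vderiv ^^ m) ?f t) has_vector_derivative
       (vderiv ^^ Suc m) ?f (h + 1 * t) - (vderiv ^^ Suc m) ?f t) (at t)"
      by (intro has_vector_derivative_diff shifted smooth_has_vector_derivative tf_apply_smooth)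
    then show ?thesis by (simp add: Suc)
  qed
  obtain a where a: "\<And>t. \<bar>t\<bar> > a \<Longrightarrow> ?f t = 0" "a > 0"
    using tf_apply_support_bound by blast
  have "smooth g" by (rule smoothI(1)[of ?F, OF _ F]) simp
  moreover have "compact (tsupport g)"
  proof (rule compact_tsupportI)
    show "compact {- a - h..a}" by simp
    fix t assume "t \<notin> {- a - h..a}"
    then have "?f s = 0" if "s \<in> {t..t + h}" for s
      using that h a by (intro a(1)) auto
    then show "g t = 0"
      unfolding g_def by (metis (no_types, lifting) integral_cong integral_0)
  qed
  ultimately have g: "tf_apply (Abs_test_fun g) = g" by (intro Abs_test_fun_inverse) simp
  have "vderiv g = (\<lambda>t. ?f (h + 1 * t) - ?f t)"
    using smoothI(2)[of ?F g 1, OF _ F] by simp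
  then have "tf_apply (tf_deriv (Abs_test_fun g)) = tf_apply (tf_shift h \<phi> - \<phi>)"
    by (simp add: fun_eq_iff tf_apply_minus tf_deriv.rep_eq tf_shift.rep_eq g add.commute)
  then show ?thesis by (auto simp: tf_apply_inject)
qed


section \<open>Regularizations of a distribution are continuous\<close>

lemma tf_reflect_vderiv:
  "(vderiv ^^ n) (tf_apply (tf_reflect x \<phi>)) t = (- 1) ^ n *\<^sub>R (vderiv ^^ n) (tf_apply \<phi>) (x - t)"
  using fun_cong[OF vderiv_affine[OF tf_apply_smooth[of \<phi>], of n x "- 1"], of t]
  by (simp add: tf_reflect.rep_eq)

lemma vderiv_minus:
  fixes \<phi> \<psi> :: "'k::real_normed_field test_fun"
  shows "(vderiv ^^ n) (tf_apply (\<phi> - \<psi>)) t =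
    (vderiv ^^ n) (tf_apply \<phi>) t - (vderiv ^^ n) (tf_apply \<psi>) t"
proof -
  have "tf_apply (\<phi> - \<psi>) = (\<lambda>t. tf_apply \<phi> t + (- 1) * tf_apply \<psi> t)"
    by (simp add: fun_eq_iff tf_apply_minus)
  then show ?thesis
    by (simp only: vderiv_add vderiv_mult smooth_mult tf_apply_smooth) simp
qed

text \<open>
  The next derivative is continuous with compact support, hence bounded, and its bound serves as a
  Lipschitz constant.
\<close>

lemma vderiv_lipschitz:
  fixes \<phi> :: "'k::real_normed_field test_fun"
  obtains C where "C > 0"
    "\<And>s t. norm ((vderiv ^^ n) (tf_apply \<phi>) s - (vderiv ^^ n) (tf_apply \<phi>) t) \<le> C * \<bar>s - t\<bar>"
proof -
  let ?d = "\<lambda>n. (vderiv ^^ n) (tf_apply \<phi>)"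
  have supp: "compact (tsupport (?d k))" for k
    by (induction k) (simp_all add: tf_apply_compact compact_tsupport_vderiv)
  have "compact (?d (Suc n) ` tsupport (?d (Suc n)))"
    by (intro compact_continuous_image smooth_continuous_on tf_apply_smooth supp)
  then obtain C where C: "C > 0" "\<And>t. t \<in> tsupport (?d (Suc n)) \<Longrightarrow> norm (?d (Suc n) t) \<le> C"
    using compact_imp_bounded by (metis bounded_pos imageI)
  have bound: "norm (?d (Suc n) t) \<le> C" for t
    using C outside_tsupport[of t "?d (Suc n)"] by (cases "t \<in> tsupport (?d (Suc n))") auto
  have "norm (?d n s - ?d n t) \<le> C * norm (s - t)" for s t
  proof (rule differentiable_bound[of UNIV])
    fix u :: real
    show "(?d n has_derivative (\<lambda>v. v *\<^sub>R ?d (Suc n) u)) (at u within UNIV)"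
      using smooth_has_vector_derivative[OF tf_apply_smooth] by (simp add: has_vector_derivative_def)
    show "onorm (\<lambda>v. v *\<^sub>R ?d (Suc n) u) \<le> C"
    proof (rule onorm_le)
      fix v :: real
      show "norm (v *\<^sub>R ?d (Suc n) u) \<le> C * norm v"
        using mult_left_mono[OF bound[of u], of "\<bar>v\<bar>"] by (simp add: mult.commute)
    qed
  qed auto
  with C(1) show thesis by (intro that[of C]) auto
qed

lemma vderiv_small_shift:
  fixes \<phi> :: "'k::real_normed_field test_fun"
  assumes "e > 0"
  shows "\<exists>d>0. \<forall>j\<le>N. \<forall>s t. \<bar>s - t\<bar> < d \<longrightarrow>
    norm ((vderiv ^^ j) (tf_apply \<phi>) s - (vderiv ^^ j) (tf_apply \<phi>) t) < e"
proof -
  have "\<exists>d>0. \<forall>s t. \<bar>s - t\<bar> < d \<longrightarrow>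
      norm ((vderiv ^^ j) (tf_apply \<phi>) s - (vderiv ^^ j) (tf_apply \<phi>) t) < e" for j
  proof -
    obtain C where C: "C > 0"
      "\<And>s t. norm ((vderiv ^^ j) (tf_apply \<phi>) s - (vderiv ^^ j) (tf_apply \<phi>) t) \<le> C * \<bar>s - t\<bar>"
      using vderiv_lipschitz by blast
    show ?thesis
    proof (intro exI[of _ "e / C"] conjI allI impI)
      fix s t assume "\<bar>s - t\<bar> < e / C"
      then have "C * \<bar>s - t\<bar> < e" using C(1) by (simp add: field_simps)
      with C(2)[of s t]
      show "norm ((vderiv ^^ j) (tf_apply \<phi>) s - (vderiv ^^ j) (tf_apply \<phi>) t) < e" by linarith
    qed (use C assms in simp)
  qed
  then obtain d where d: "\<And>j. d j > 0" "\<And>j s t. \<bar>s - t\<bar> < d j \<Longrightarrow>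
      norm ((vderiv ^^ j) (tf_apply \<phi>) s - (vderiv ^^ j) (tf_apply \<phi>) t) < e"
    by metis
  show ?thesis
    by (rule exI[of _ "Min (d ` {..N})"]) (use d in auto)
qed

text \<open>
  Near a point \<open>x\<close>, the test functions \<open>\<phi>(y - \<cdot>)\<close> are supported in a common compact set, where
  membership in a neighbourhood of \<open>0\<close> is governed by finitely many derivatives.
\<close>

lemma tf_reflect_continuous:
  fixes \<phi> :: "'k::real_normed_field test_fun"
  assumes "tf_nbhd0 W"
  shows "\<exists>d>0. \<forall>y. \<bar>y - x\<bar> < d \<longrightarrow> tf_reflect y \<phi> - tf_reflect x \<phi> \<in> W"
proof -
  obtain a where a: "\<And>t. \<bar>t\<bar> > a \<Longrightarrow> tf_apply \<phi> t = 0" "a > 0"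
    using tf_apply_support_bound by blast
  let ?K = "{x - a - 1..x + a + 1}"
  have "\<exists>N. \<exists>\<epsilon>>0. \<forall>\<phi>. tsupport (tf_apply \<phi>) \<subseteq> ?K \<and>
      (\<forall>j\<le>N. \<forall>t. norm ((vderiv ^^ j) (tf_apply \<phi>) t) < \<epsilon>) \<longrightarrow> \<phi> \<in> W"
    using assms unfolding tf_nbhd0_def by blast
  then obtain N \<epsilon> where \<epsilon>: "\<epsilon> > 0" and W: "\<forall>\<phi>. tsupport (tf_apply \<phi>) \<subseteq> ?K \<and>
      (\<forall>j\<le>N. \<forall>t. norm ((vderiv ^^ j) (tf_apply \<phi>) t) < \<epsilon>) \<longrightarrow> \<phi> \<in> W"
    by (elim exE conjE)
  obtain d where d: "d > 0" "\<forall>j\<le>N. \<forall>s t. \<bar>s - t\<bar> < d \<longrightarrow>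
      norm ((vderiv ^^ j) (tf_apply \<phi>) s - (vderiv ^^ j) (tf_apply \<phi>) t) < \<epsilon>"
    using vderiv_small_shift[OF \<epsilon>, of N \<phi>] by (elim exE conjE)
  show ?thesis
  proof (intro exI[of _ "min d 1"] conjI allI impI)
    fix y assume y: "\<bar>y - x\<bar> < min d 1"
    show "tf_reflect y \<phi> - tf_reflect x \<phi> \<in> W"
    proof (rule W[rule_format], intro conjI allI impI)
      have "{t. tf_apply (tf_reflect y \<phi> - tf_reflect x \<phi>) t \<noteq> 0} \<subseteq> ?K"
      proof
        fix t assume "t \<in> {t. tf_apply (tf_reflect y \<phi> - tf_reflect x \<phi>) t \<noteq> 0}"
        then have "tf_apply \<phi> (y - t) \<noteq> 0 \<or> tf_apply \<phi> (x - t) \<noteq> 0"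
          by (auto simp: tf_apply_minus tf_reflect.rep_eq)
        then have "\<bar>y - t\<bar> \<le> a \<or> \<bar>x - t\<bar> \<le> a" using a(1) by (meson not_le)
        then show "t \<in> ?K" using y by auto
      qed
      then show "tsupport (tf_apply (tf_reflect y \<phi> - tf_reflect x \<phi>)) \<subseteq> ?K"
        unfolding tsupport_def by (rule closure_minimal) simp
      fix j t assume "j \<le> N"
      then show "norm ((vderiv ^^ j) (tf_apply (tf_reflect y \<phi> - tf_reflect x \<phi>)) t) < \<epsilon>"
        using d(2)[rule_format, of j "y - t" "x - t"] y
        by (simp add: vderiv_minus tf_reflect_vderiv flip: scaleR_diff_right)
    qed
  qed (use d in simp)
qed

lemma dist_conv_continuous:
  assumes "S \<in> distributions smul"
  shows "continuous_on A (dist_conv S \<phi>)"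
proof -
  have S: "continuous_on UNIV S" using assms by (simp add: distributions_def)
  have "\<exists>d>0. \<forall>y. dist y x < d \<longrightarrow> dist (dist_conv S \<phi> y) (dist_conv S \<phi> x) < e"
    if "e > 0" for x e
  proof -
    have "open (S -` ball (dist_conv S \<phi> x) e)" by (intro open_vimage open_ball S)
    moreover have "tf_reflect x \<phi> \<in> S -` ball (dist_conv S \<phi> x) e"
      using that by (simp add: dist_conv_def)
    ultimately obtain W where W: "tf_nbhd0 W"
      "\<And>\<psi>. \<psi> \<in> W \<Longrightarrow> tf_reflect x \<phi> + \<psi> \<in> S -` ball (dist_conv S \<phi> x) e"
      unfolding open_test_fun_def by blast
    obtain d where d: "d > 0"
      "\<And>y. \<bar>y - x\<bar> < d \<Longrightarrow> tf_reflect y \<phi> - tf_reflect x \<phi> \<in> W"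
      using tf_reflect_continuous[OF W(1)] by blast
    have "dist (dist_conv S \<phi> y) (dist_conv S \<phi> x) < e" if "\<bar>y - x\<bar> < d" for y
      using W(2)[OF d(2)[OF that]] by (simp add: dist_conv_def dist_commute)
    then show ?thesis using d(1) by (auto simp: dist_real_def)
  qed
  then show ?thesis
    by (intro continuous_at_imp_continuous_on) (simp add: continuous_at_eps_delta)
qed


section \<open>Distributions defined by continuous functions\<close>

lemma (in banach_space_over) bounded_bilinear_smul: "bounded_bilinear smul"
proof
  fix r c x
  show "smul (r *\<^sub>R c) x = r *\<^sub>R smul c x"
    by (simp add: scaleR_conv_of_real flip: smul_of_real)
  have "smul c (r *\<^sub>R x) = smul (c * of_real r) x"
    by (simp flip: smul_of_real)
  also have "\<dots> = r *\<^sub>R smul c x"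
    by (simp add: mult.commute flip: smul_of_real)
  finally show "smul c (r *\<^sub>R x) = r *\<^sub>R smul c x" .
  show "\<exists>K. \<forall>a b. norm (smul a b) \<le> norm a * norm b * K"
    by (rule exI[of _ 1]) (simp add: norm_smul)
qed (rule scale_left_distrib scale_right_distrib)+

lemma (in banach_space_over) smul_test_fun_integrable:
  assumes f: "continuous_on UNIV f"
  shows "(\<lambda>t. smul (tf_apply \<phi> t) (f t)) integrable_on UNIV"
proof -
  obtain a where a: "\<And>t. \<bar>t\<bar> > a \<Longrightarrow> tf_apply \<phi> t = 0" "a > 0"
    using tf_apply_support_bound by blast
  have "continuous_on {- a..a} (\<lambda>t. smul (tf_apply \<phi> t) (f t))"
    using smooth_continuous_on[OF tf_apply_smooth[of \<phi>], of _ 0]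
    by (intro bounded_bilinear.continuous_on[OF bounded_bilinear_smul] continuous_on_subset[OF f]) auto
  then have "(\<lambda>t. smul (tf_apply \<phi> t) (f t)) integrable_on {- a..a}"
    by (rule integrable_continuous_real)
  then show ?thesis
    by (rule integrable_on_superset) (use a(1) in auto)
qed

lemma has_integral_UNIV_translate:
  fixes f :: "real \<Rightarrow> 'a::banach"
  assumes f: "(f has_integral I) UNIV"
  shows "((\<lambda>t. f (t + h)) has_integral I) UNIV"
proof -
  have "\<exists>B>0. \<forall>a b. ball 0 B \<subseteq> cbox a b \<longrightarrow>
      (\<exists>z. ((\<lambda>t. f (t + h)) has_integral z) (cbox a b) \<and> norm (z - I) < e)" if "e > 0" for e
  proof -
    obtain B where B: "B > 0" "\<And>a b. ball 0 B \<subseteq> cbox a b \<Longrightarrow>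
        \<exists>z. (f has_integral z) (cbox a b) \<and> norm (z - I) < e"
      using f[unfolded has_integral'[of f I UNIV], simplified if_True UNIV_I, rule_format, OF \<open>e > 0\<close>]
      by blast
    show ?thesis
      \<comment> \<open>The margin \<open>\<bar>h\<bar>\<close> makes the interval translated by \<open>h\<close> still contain the ball of radius \<open>B\<close>.\<close>
    proof (intro exI[of _ "B + \<bar>h\<bar>"] conjI allI impI)
      fix a b :: real assume ab: "ball 0 (B + \<bar>h\<bar>) \<subseteq> cbox a b"
      have "ball 0 B \<subseteq> cbox (a + h) (b + h)"
      proof
        fix t assume "t \<in> ball (0::real) B"
        then have "t - h \<in> ball 0 (B + \<bar>h\<bar>)" by auto
        then have "t - h \<in> cbox a b" using ab by blast
        then show "t \<in> cbox (a + h) (b + h)" by auto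
      qed
      then obtain z where "(f has_integral z) (cbox (a + h) (b + h))" "norm (z - I) < e"
        using B(2) by blast
      then show "\<exists>z. ((\<lambda>t. f (t + h)) has_integral z) (cbox a b) \<and> norm (z - I) < e"
        using has_integral_shift_cbox[of f z "a + h" "b + h" h] by auto
    qed (use B(1) in simp)
  qed
  then show ?thesis by (subst has_integral') simp
qed

lemma (in banach_space_over) dist_diff_dist_of_fun:
  assumes f: "continuous_on UNIV f"
  shows "dist_diff h (dist_of_fun smul f) = dist_of_fun smul (\<lambda>t. f (t + h) - f t)"
proof
  fix \<phi>
  have fh: "continuous_on UNIV (\<lambda>t. f (t + h))"
    by (rule continuous_on_compose2[OF f]) (auto intro!: continuous_intros)
  have "dist_translate h (dist_of_fun smul f) \<phi> =
      integral UNIV (\<lambda>t. smul (tf_apply (tf_shift (- h) \<phi>) t) (f t))"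
    by (simp add: dist_translate_def dist_of_fun_def)
  also have "\<dots> = integral UNIV (\<lambda>t. smul (tf_apply (tf_shift (- h) \<phi>) (t + h)) (f (t + h)))"
    by (rule integral_unique[symmetric, OF has_integral_UNIV_translate])
      (rule integrable_integral[OF smul_test_fun_integrable[OF f]])
  also have "\<dots> = integral UNIV (\<lambda>t. smul (tf_apply \<phi> t) (f (t + h)))"
    by (simp add: tf_shift.rep_eq)
  finally have "dist_diff h (dist_of_fun smul f) \<phi> =
      integral UNIV (\<lambda>t. smul (tf_apply \<phi> t) (f (t + h))) - integral UNIV (\<lambda>t. smul (tf_apply \<phi> t) (f t))"
    by (simp add: dist_diff_def dist_of_fun_def)
  also have "\<dots> = dist_of_fun smul (\<lambda>t. f (t + h) - f t) \<phi>"
    using f fh by (simp add: dist_of_fun_def scale_right_diff_distrib smul_test_fun_integrable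
        flip: Henstock_Kurzweil_Integration.integral_diff)
  finally show "dist_diff h (dist_of_fun smul f) \<phi> = dist_of_fun smul (\<lambda>t. f (t + h) - f t) \<phi>" .
qed


section \<open>Differences of regularized antiderivatives\<close>

text \<open>
  Both signs from integration by parts occur here: one in the definition of \<open>S'\<close>, the other from
  differentiating \<open>y \<mapsto> \<psi>(x - y)\<close>. They cancel, so \<open>S * \<psi>' = S' * \<psi>\<close>.
\<close>

lemma dist_conv_tf_deriv: "dist_conv S (tf_deriv \<psi>) = dist_conv (dist_deriv S) \<psi>"
  if "S \<in> distributions smul"
proof
  fix x
  interpret S: Vector_Spaces.linear tf_scale smul S
    using that by (simp add: distributions_def)
  have "vderiv (tf_apply (tf_reflect x \<psi>)) t = - vderiv (tf_apply \<psi>) (x - t)" for t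
    using tf_reflect_vderiv[of 1 x \<psi> t] by simp
  then have "tf_apply (tf_reflect x (tf_deriv \<psi>)) t =
      tf_apply (tf_scale (- 1) (tf_deriv (tf_reflect x \<psi>))) t" for t
    by (simp only: tf_reflect.rep_eq[of x "tf_deriv \<psi>"] tf_deriv.rep_eq tf_scale.rep_eq) simp
  then have "tf_reflect x (tf_deriv \<psi>) = - tf_deriv (tf_reflect x \<psi>)"
    by (simp only: uminus_test_fun_def flip: tf_apply_inject) (simp add: fun_eq_iff)
  then show "dist_conv S (tf_deriv \<psi>) x = dist_conv (dist_deriv S) \<psi> x"
    by (simp add: dist_conv_def dist_deriv_def S.neg)
qed

lemma dist_conv_shift_minus:
  assumes "S \<in> distributions smul"
  shows "dist_conv S \<phi> (x + h) - dist_conv S \<phi> x = dist_conv S (tf_shift h \<phi> - \<phi>) x"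
proof -
  interpret S: Vector_Spaces.linear tf_scale smul S
    using assms by (simp add: distributions_def)
  have "tf_apply (tf_reflect (x + h) \<phi> - tf_reflect x \<phi>) = tf_apply (tf_reflect x (tf_shift h \<phi> - \<phi>))"
    by (simp add: fun_eq_iff tf_apply_minus tf_reflect.rep_eq tf_shift.rep_eq algebra_simps)
  then have "tf_reflect (x + h) \<phi> - tf_reflect x \<phi> = tf_reflect x (tf_shift h \<phi> - \<phi>)"
    by (simp add: tf_apply_inject)
  then show ?thesis by (simp add: dist_conv_def flip: S.diff)
qed

lemma dist_diff_regularization_in_class:
  fixes smul :: "'k::{real_normed_field,banach} \<Rightarrow> 'x::banach \<Rightarrow> 'x"
  assumes X: "banach_space_over smul"
    and S: "S \<in> distributions smul" and deriv: "dist_deriv S \<in> conv_class smul \<A>" and h: "h > 0"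
  shows "dist_diff h (dist_of_fun smul (dist_conv S \<phi>)) \<in> \<A>"
proof -
  obtain \<psi> where \<psi>: "tf_deriv \<psi> = tf_shift h \<phi> - \<phi>"
    using tf_shift_minus_is_tf_deriv[OF h] by blast
  have "(\<lambda>x. dist_conv S \<phi> (x + h) - dist_conv S \<phi> x) = dist_conv (dist_deriv S) \<psi>"
    by (simp only: dist_conv_shift_minus[OF S] dist_conv_tf_deriv[OF S] flip: \<psi>)
  then have "dist_diff h (dist_of_fun smul (dist_conv S \<phi>)) =
      dist_of_fun smul (dist_conv (dist_deriv S) \<psi>)"
    by (simp add: banach_space_over.dist_diff_dist_of_fun[OF X dist_conv_continuous[OF S]])
  then show ?thesis using deriv by (simp add: conv_class_def)
qed

theorem corollary6p6:
  fixes smul :: "'k::{real_normed_field,banach} \<Rightarrow> 'x::banach \<Rightarrow> 'x"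
    and U \<A> :: "('k test_fun \<Rightarrow> 'x) set"
    and P :: "('k test_fun \<Rightarrow> 'x) \<Rightarrow> ('k test_fun \<Rightarrow> 'x)"
    and T :: "'k test_fun \<Rightarrow> 'x"
  assumes X: "banach_space_over smul"
    and P_continuous: "continuous_map (dist_topology smul) (dist_topology smul) P"
    and P_add: "\<And>S R. S \<in> distributions smul \<Longrightarrow> R \<in> distributions smul \<Longrightarrow> P (S + R) = P S + P R"
    and P_scale: "\<And>c S. S \<in> distributions smul \<Longrightarrow> P (dist_scale smul c S) = dist_scale smul c (P S)"
    and P_deriv: "\<And>S. S \<in> distributions smul \<Longrightarrow> dist_deriv (P S) = S"
    and "U \<subseteq> distributions smul" and "\<A> \<subseteq> distributions smul"
    and loomis: "loomis U \<A>"
    and linear: "module.subspace (dist_scale smul) \<A>"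
    and constants: "\<And>x. dist_of_fun smul (\<lambda>_. x) \<in> \<A>"
    and "T \<in> conv_class smul \<A>"
    and "P T \<in> conv_class smul U"
  shows "P T \<in> conv_class smul \<A>"
proof -
  have S: "P T \<in> distributions smul" "\<And>\<phi>. dist_of_fun smul (dist_conv (P T) \<phi>) \<in> U"
    using \<open>P T \<in> conv_class smul U\<close> by (auto simp: conv_class_def)
  have "T \<in> distributions smul" using \<open>T \<in> conv_class smul \<A>\<close> by (simp add: conv_class_def)
  then have "dist_deriv (P T) \<in> conv_class smul \<A>"
    using P_deriv \<open>T \<in> conv_class smul \<A>\<close> by simp
  then have "dist_diff h (dist_of_fun smul (dist_conv (P T) \<phi>)) \<in> \<A>" if "h > 0" for h \<phi>
    using dist_diff_regularization_in_class[OF X S(1)] that by blast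
  then have "dist_of_fun smul (dist_conv (P T) \<phi>) \<in> \<A>" for \<phi>
    using loomis S(2) unfolding loomis_def by blast
  then show ?thesis using S(1) by (simp add: conv_class_def)
qed

end
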